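(* Let $V=v(X)$ be the standardized version of a random vector $X$ in $\mathbb{R}^d$ with law $P$, assumed regularly varying with exponent measure $\mu$, with angular measure $\Phi_{\mathrm{s}}$ and normalized angular measure $\Phi_{s,1}$. Let $$B_1(t)=\sup_{y:\|y\|\ge t}\Big|\,\|y\|\,\mathrm{pD}(y;v_\#P)-\mathrm{aD}(\theta(y);\Phi_{\mathrm{s}})\Big|,\qquad t>0.$$ If $$\sup_{u\in\mathbb{S}}\Big|\mathbb{P}\big[\theta(V)\in H_{0,u}\cap\mathbb{S}\ \big|\ \|V\|>t\big]-\Phi_{s,1}(H_{0,u}\cap\mathbb{S})\Big|\xrightarrow[t\to\infty]{}0,$$ then $B_1(t)\to0$ as $t\to\infty$.
   Context: Let $d\ge2$, $\langle\cdot,\cdot\rangle,\|\cdot\|$ the Euclidean inner product and norm, $\mathbb{S}$ the unit sphere, $\mathbb{B}$ the open unit ball of $\mathbb{R}^d$; $\theta(x)=x/\|x\|$ for $x\ne0$; $H_{0,u}=\{y:\langle y,u\rangle\ge0\}$. $X=(X_1,\dots,X_d)$ has law $P$ and continuous marginal distribution functions $F_1,\dots,F_d$. Set $v_j(y)=(1-F_j(y))^{-1}$, $v(x)=(v_1(x_1),\dots,v_d(x_d))$, $V=v(X)$ (so each $V_j$ is unit Pareto), and $v_\#P$ is the law of $V$. Standing assumption: there is a nonzero Borel measure $\mu$ on $\mathbb{R}^d\setminus\{0\}$ (the exponent measure), finite on sets bounded away from $0$, with $t\,\mathbb{P}(t^{-1}V\in B)\to\mu(B)$ as $t\to\infty$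 for all Borel $B$ bounded away from the origin with $\mu(\partial B)=0$. Then $\mu(tB)=t^{-1}\mu(B)$ for $t>0$. Define on $\mathbb{S}$: $\Phi_{\mathrm{s}}(A)=\mu(\{tw:w\in A,t\ge1\})$ (a finite measure) and $\Phi_{s,1}=\mu(\mathbb{B}^c)^{-1}\Phi_{\mathrm{s}}$ (a probability measure). Polar depth: $\mathrm{pD}(y;\pi)=\inf\{\pi(\{z:\|z\|\ge\|y\|,\ z\in H_{0,u}\}):u\in\mathbb{S},\ y\in H_{0,u}\}$ for $y\ne0$. Angular halfspace depth for a finite positive measure $\varphi$ on $\mathbb{S}$: $\mathrm{aD}(w;\varphi)=\inf\{\varphi(\mathbb{S}\cap H_{0,u}):u\in\mathbb{S},\,w\in H_{0,u}\}$. *)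

theory Defs
  imports "HOL-Probability.Probability"
begin

definition halfspace0 :: "'a::real_inner \<Rightarrow> 'a set" where
  "halfspace0 u = {y. inner y u \<ge> 0}"

definition polar_depth :: "'a::euclidean_space \<Rightarrow> 'a measure \<Rightarrow> real" where
  "polar_depth y \<pi> =
     (INF u \<in> {u \<in> sphere 0 1. y \<in> halfspace0 u}.
        measure \<pi> {z. norm z \<ge> norm y \<and> z \<in> halfspace0 u})"

definition angular_depth :: "'a::euclidean_space \<Rightarrow> 'a measure \<Rightarrow> real" where
  "angular_depth w \<phi> =
     (INF u \<in> {u \<in> sphere 0 1. w \<in> halfspace0 u}.
        measure \<phi> (sphere 0 1 \<inter> halfspace0 u))"

definition marginal_cdf :: "(real ^ 'n) measure \<Rightarrow> 'n \<Rightarrow> real \<Rightarrow> real" where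
  "marginal_cdf P j = cdf (distr P borel (\<lambda>x. x $ j))"

text \<open>Where a marginal distribution function equals 1, the coordinate of \<open>standardize P x\<close> is
  \<open>1 / 0 = 0\<close> instead of infinity. If the marginal distribution functions of \<open>P\<close> are continuous,
  this happens only on a \<open>P\<close>-null set, so that the law of the standardized vector is unaffected.\<close>

definition standardize :: "(real ^ 'n) measure \<Rightarrow> real ^ 'n \<Rightarrow> real ^ 'n" where
  "standardize P x = (\<chi> j. 1 / (1 - marginal_cdf P j (x $ j)))"

lemma measurable_standardize:
  fixes P :: "(real ^ 'n) measure"
  assumes "finite_measure P" "sets P = sets borel"
  shows "standardize P \<in> borel \<rightarrow>\<^sub>M borel"
proof -
  have [measurable]: "marginal_cdf P j \<in> borel \<rightarrow>\<^sub>M borel" for j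
  proof (rule borel_measurable_mono, rule monoI)
    fix a b :: real assume "a \<le> b"
    have "(\<lambda>x. x $ j) \<in> P \<rightarrow>\<^sub>M borel"
      unfolding measurable_cong_sets[OF assms(2) refl] by measurable
    then interpret finite_measure "distr P borel (\<lambda>x. x $ j)"
      by (rule finite_measure.finite_measure_distr[OF assms(1)])
    show "marginal_cdf P j a \<le> marginal_cdf P j b"
      unfolding marginal_cdf_def cdf_def
      using \<open>a \<le> b\<close> by (intro finite_measure_mono) auto
  qed
  have "(\<lambda>x. standardize P x $ j) \<in> borel \<rightarrow>\<^sub>M borel" for j
    unfolding standardize_def by simp
  then show ?thesis
    unfolding borel_measurable_euclidean_space[of "standardize P"]
    by (auto simp: Basis_vec_def inner_axis)
qed

definition bounded_away_from_0 :: "'a::real_normed_vector set \<Rightarrow> bool" where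
  "bounded_away_from_0 B \<longleftrightarrow> (\<exists>r>0. \<forall>x\<in>B. norm x \<ge> r)"

text \<open>\<open>\<mu>\<close> lives on the punctured space \<open>- {0}\<close>. For a set bounded away from 0, the boundary in
  \<open>- {0}\<close> coincides with the boundary in the whole space, \<open>frontier B\<close>.\<close>

definition exponent_measure ::
    "'w measure \<Rightarrow> ('w \<Rightarrow> 'a::euclidean_space) \<Rightarrow> 'a measure \<Rightarrow> bool" where
  "exponent_measure M V \<mu> \<longleftrightarrow>
     sets \<mu> = sets (restrict_space borel (- {0})) \<and>
     emeasure \<mu> (space \<mu>) \<noteq> 0 \<and>
     (\<forall>B \<in> sets borel. bounded_away_from_0 B \<longrightarrow> emeasure \<mu> B < \<infinity>) \<and>
     (\<forall>B \<in> sets borel. bounded_away_from_0 B \<longrightarrow> emeasure \<mu> (frontier B) = 0 \<longrightarrow>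
        ((\<lambda>t. t * \<P>(\<omega> in M. V \<omega> /\<^sub>R t \<in> B)) \<longlongrightarrow> measure \<mu> B) at_top)"

definition angular_measure :: "'a::euclidean_space measure \<Rightarrow> 'a measure" where
  "angular_measure \<mu> =
     measure_of (sphere 0 1) (sets (restrict_space borel (sphere 0 1)))
       (\<lambda>A. emeasure \<mu> {t *\<^sub>R w | t w. w \<in> A \<and> t \<ge> 1})"

definition normalized_angular_measure :: "'a::euclidean_space measure \<Rightarrow> 'a measure" where
  "normalized_angular_measure \<mu> =
     scale_measure (1 / emeasure \<mu> (- ball 0 1)) (angular_measure \<mu>)"

text \<open>The set function in \<open>angular_measure\<close> is countably additive, so \<open>measure_of\<close> does not
  collapse it.\<close>

lemma emeasure_angular_measure:
  fixes \<mu> :: "'a::euclidean_space measure"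
  assumes sets: "sets \<mu> = sets (restrict_space borel (- {0}))"
    and A: "A \<in> sets (restrict_space borel (sphere 0 1))"
  shows "emeasure (angular_measure \<mu>) A = emeasure \<mu> {t *\<^sub>R w | t w. w \<in> A \<and> t \<ge> 1}"
proof -
  let ?S = "restrict_space borel (sphere 0 1) :: 'a measure"
  let ?N = "restrict_space \<mu> {x. norm x \<ge> 1}"
  let ?D = "distr ?N ?S sgn"
  have sp: "space \<mu> = - {0}"
    using sets_eq_imp_space_eq[OF sets] by (simp add: space_restrict_space)
  have out: "{x::'a. norm x \<ge> 1} \<in> sets \<mu>"
    unfolding sets by (subst sets_restrict_space_iff) (auto simp: subset_iff)
  have sub: "{x::'a. norm x \<ge> 1} \<subseteq> - {0}"
    by auto
  have sgn_borel: "(sgn :: 'a \<Rightarrow> 'a) \<in> borel \<rightarrow>\<^sub>M borel"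
    unfolding sgn_div_norm[abs_def] by measurable
  have N: "sets ?N = sets (restrict_space borel {x::'a. norm x \<ge> 1})"
    unfolding restrict_space_sets_cong[OF refl sets]
    by (subst sets_restrict_restrict_space) (metis Int_absorb1 sub)
  have "sgn \<in> restrict_space borel {x::'a. norm x \<ge> 1} \<rightarrow>\<^sub>M (borel :: 'a measure)"
    by (rule measurable_restrict_space1[OF sgn_borel])
  then have "sgn \<in> ?N \<rightarrow>\<^sub>M borel"
    unfolding measurable_cong_sets[OF N refl] .
  moreover have "sgn x \<in> sphere 0 1" if "x \<in> space ?N" for x
    using that by (auto simp: space_restrict_space norm_sgn)
  ultimately have meas: "sgn \<in> ?N \<rightarrow>\<^sub>M ?S"
    by (intro measurable_restrict_space2) auto
  have cone: "emeasure \<mu> {t *\<^sub>R w | t w. w \<in> C \<and> t \<ge> 1} = emeasure ?D C" if "C \<in> sets ?S" for C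
  proof -
    have Csub: "C \<subseteq> sphere 0 1"
      using sets.sets_into_space[OF that] by (simp add: space_restrict_space)
    have "{t *\<^sub>R w | t w. w \<in> C \<and> t \<ge> 1} = sgn -` C \<inter> space ?N" (is "?L = ?R")
    proof (intro set_eqI iffI)
      fix x assume "x \<in> ?L"
      then obtain t w where x: "x = t *\<^sub>R w" and w: "w \<in> C" and t: "t \<ge> 1" by blast
      have nw: "norm w = 1" using w Csub by auto
      then have sx: "sgn x = w" and nx: "norm x = t" using t by (simp_all add: x sgn_div_norm)
      have "x \<in> space ?N"
        using nx t sub unfolding space_restrict_space sp by blast
      then show "x \<in> ?R" using sx w by simp
    next
      fix x assume "x \<in> ?R"
      then have "sgn x \<in> C" "norm x \<ge> 1" by (simp_all add: space_restrict_space)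
      moreover have "x = norm x *\<^sub>R sgn x" by (cases "x = 0") (simp_all add: sgn_div_norm)
      ultimately show "x \<in> ?L" by blast
    qed
    moreover have "emeasure ?N (sgn -` C \<inter> space ?N) = emeasure \<mu> (sgn -` C \<inter> space ?N)"
    proof (rule emeasure_restrict_space)
      show "{x. norm x \<ge> 1} \<inter> space \<mu> \<in> sets \<mu>"
        using out by (metis sets.Int_space_eq2)
      show "sgn -` C \<inter> space ?N \<subseteq> {x. norm x \<ge> 1}" unfolding space_restrict_space by blast
    qed
    ultimately show ?thesis
      using emeasure_distr[OF meas that] by simp
  qed
  have ssets: "sigma_sets (sphere 0 1) (sets ?S) = sets ?S"
    using sets.sigma_sets_eq[of ?S] by (simp add: space_restrict_space)
  have ssub: "sets ?S \<subseteq> Pow (sphere 0 1)"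
    using sets.space_closed[of ?S] by (simp add: space_restrict_space)
  have "angular_measure \<mu> = measure_of (sphere 0 1) (sets ?S) (emeasure ?D)"
    unfolding angular_measure_def
    by (rule measure_of_eq[OF ssub]) (simp add: ssets cone)
  also have "\<dots> = measure_of (space ?D) (sets ?D) (emeasure ?D)"
    by (simp add: space_restrict_space)
  also have "\<dots> = ?D"
    by (rule measure_of_of_measure)
  finally show ?thesis
    using cone[OF A] by simp
qed

end

theory Submission
  imports Defs
begin

text \<open>
  By homogeneity of the radial part of \<open>\<mu>\<close>, which follows from the convergence assumption along
  radii whose spheres are \<open>\<mu>\<close>-null, both \<open>t P(\<parallel>V\<parallel> \<ge> t)\<close> and \<open>t P(\<parallel>V\<parallel> > t)\<close> tend to
  \<open>\<mu> {x. \<parallel>x\<parallel> \<ge> 1}\<close>, the total mass of the angular measure. Multiplying the assumed uniform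
  convergence of conditional probabilities by \<open>t P(\<parallel>V\<parallel> > t)\<close> shows that
  \<open>t P(\<parallel>V\<parallel> \<ge> t, V \<in> H u)\<close> is uniformly close to the angular measure of \<open>H u\<close> over all closed
  halfspaces \<open>H u\<close>, and infima over the same set of directions inherit this bound.
\<close>

section \<open>Radii whose spheres carry no exponent mass\<close>

lemma exponent_measure_measurable:
  assumes "exponent_measure M V \<mu>" "B \<in> sets borel" "0 \<notin> B"
  shows "B \<in> sets \<mu>"
  using assms unfolding exponent_measure_def
  by (auto simp: sets_restrict_space_iff)

lemma exponent_measure_finite_tail:
  assumes "exponent_measure M V \<mu>" "0 < r"
  shows "emeasure \<mu> (- ball 0 r) < \<infinity>"
proof -
  have "- ball 0 r \<in> sets borel" "bounded_away_from_0 (- ball 0 r)"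
    using assms(2) by (auto simp: bounded_away_from_0_def intro!: exI[of _ r])
  then show ?thesis
    using assms(1) unfolding exponent_measure_def by blast
qed

text \<open>The norm pushes \<mu>, cut off inside radius \<open>a\<close>, forward to a finite
  measure on the line. Such a measure has only countably many atoms, while the interval is
  uncountable.\<close>

lemma exponent_measure_null_sphere:
  fixes V :: "'w \<Rightarrow> 'a::euclidean_space"
  assumes \<mu>: "exponent_measure M V \<mu>" and "0 < a" "a < b"
  shows "\<exists>r. a < r \<and> r < b \<and> emeasure \<mu> (sphere 0 r) = 0"
proof -
  \<comment> \<open>Cutting off by a density makes the measure finite and keeps the sigma-algebra of
    \<mu>.\<close>
  define N where "N = density \<mu> (indicator (- ball 0 a))"
  have tail: "- ball 0 a \<in> sets \<mu>"
    using \<open>0 < a\<close> by (intro exponent_measure_measurable[OF \<mu>]) auto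
  have sets_\<mu>: "sets \<mu> = sets (restrict_space borel (- {0}))"
    using \<mu> by (simp add: exponent_measure_def)
  then have "sets N = sets (restrict_space borel (- {0}))"
    by (simp add: N_def)
  moreover have "norm \<in> restrict_space borel (- {0 :: 'a}) \<rightarrow>\<^sub>M borel"
    by (intro measurable_restrict_space1) simp
  ultimately have norm_meas: "norm \<in> N \<rightarrow>\<^sub>M borel"
    by (simp cong: measurable_cong_sets)
  have "finite_measure N"
  proof
    have "emeasure N (space N) = emeasure \<mu> (- ball 0 a)"
      using tail sets.sets_into_space[OF tail] unfolding N_def
      by (simp add: emeasure_restricted Int_absorb2)
    then show "emeasure N (space N) \<noteq> \<infinity>"
      using exponent_measure_finite_tail[OF \<mu> \<open>0 < a\<close>] by simp
  qed
  then interpret D: finite_measure "distr N borel norm"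
    by (rule finite_measure.finite_measure_distr) (rule norm_meas)
  have "uncountable {a<..<b}"
    using \<open>a < b\<close> by (simp add: uncountable_open_interval)
  then have "\<not> {a<..<b} \<subseteq> {r. measure (distr N borel norm) {r} \<noteq> 0}"
    using countable_subset[OF _ D.countable_support] by blast
  then obtain r where r: "a < r" "r < b" "measure (distr N borel norm) {r} = 0"
    by auto
  have space_N: "space N = - {0}"
    using sets_eq_imp_space_eq[OF sets_\<mu>] by (simp add: N_def space_restrict_space)
  have "r \<noteq> 0"
    using r(1) \<open>0 < a\<close> by linarith
  then have pre: "norm -` {r} \<inter> space N = sphere 0 r"
    unfolding space_N by (auto simp only: vimage_eq mem_sphere_0 singleton_iff Compl_iff norm_zero)
  have sphere: "sphere 0 r \<in> sets \<mu>"
    using r(1) \<open>0 < a\<close> by (intro exponent_measure_measurable[OF \<mu>]) (auto intro: borel_closed)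
  have "emeasure (distr N borel norm) {r} = emeasure N (sphere 0 r)"
    using pre by (simp add: emeasure_distr[OF norm_meas])
  also have "\<dots> = emeasure \<mu> (- ball 0 a \<inter> sphere 0 r)"
    unfolding N_def by (rule emeasure_restricted[OF tail sphere])
  also have "- ball 0 a \<inter> sphere 0 r = sphere 0 r"
    using r(1) by auto
  finally show ?thesis
    using r by (auto simp: D.emeasure_eq_measure)
qed

section \<open>Tail of the norm and radial homogeneity\<close>

text \<open>The complements of the open and of the closed ball of radius \<open>r\<close> both have
  the null sphere as frontier, so the defining convergence applies to them; running it at time
  \<open>t / r\<close> turns the threshold \<open>r\<close> into \<open>t\<close>. The functions of
  \<open>t\<close> do not involve \<open>r\<close>, so the limit cannot depend on it: this is
  homogeneity along null radii.\<close>

lemma radial_tail_scaled: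
  fixes V :: "'w \<Rightarrow> 'a::euclidean_space"
  assumes \<mu>: "exponent_measure M V \<mu>" and "0 < r" and null: "emeasure \<mu> (sphere 0 r) = 0"
  shows "((\<lambda>t. t * \<P>(\<omega> in M. t \<le> norm (V \<omega>))) \<longlongrightarrow> r * measure \<mu> (- ball 0 r)) at_top"
    and "((\<lambda>t. t * \<P>(\<omega> in M. t < norm (V \<omega>))) \<longlongrightarrow> r * measure \<mu> (- ball 0 r)) at_top"
proof -
  have lim: "((\<lambda>t. t * \<P>(\<omega> in M. V \<omega> /\<^sub>R t \<in> B)) \<longlongrightarrow> measure \<mu> B) at_top"
    if "B \<in> sets borel" "bounded_away_from_0 B" "frontier B = sphere 0 r" for B
    using \<mu> that null unfolding exponent_measure_def by simp
  \<comment> \<open>Time change \<open>t / r\<close>; the prefactor \<open>t / r\<close> has to be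
    multiplied by \<open>r\<close> to become \<open>t\<close> again.\<close>
  have resc: "((\<lambda>t. t * p t) \<longlongrightarrow> r * l) at_top"
    if "((\<lambda>t. t * q t) \<longlongrightarrow> l) at_top" "\<And>t. 0 < t \<Longrightarrow> q (t / r) = p t" for p q :: "real \<Rightarrow> real" and l
  proof -
    have "filterlim (\<lambda>t. t / r) at_top at_top"
      using \<open>0 < r\<close> by real_asymp
    from filterlim_compose[OF that(1) this]
    have "((\<lambda>t. r * (t / r * q (t / r))) \<longlongrightarrow> r * l) at_top"
      by (rule tendsto_mult_left)
    then show ?thesis
      by (rule Lim_transform_eventually)
        (use \<open>0 < r\<close> that(2) in \<open>auto intro!: eventually_mono[OF eventually_gt_at_top[of 0]]\<close>)
  qed
  have away: "bounded_away_from_0 (- ball 0 r :: 'a set)" "bounded_away_from_0 (- cball 0 r :: 'a set)"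
    using \<open>0 < r\<close> by (auto simp: bounded_away_from_0_def intro!: exI[of _ r])
  show "((\<lambda>t. t * \<P>(\<omega> in M. t \<le> norm (V \<omega>))) \<longlongrightarrow> r * measure \<mu> (- ball 0 r)) at_top"
    by (rule resc[OF lim[OF _ away(1)]])
      (use \<open>0 < r\<close> in \<open>auto simp: frontier_complement field_simps not_less\<close>)
  have "measure \<mu> (- ball 0 r) = measure \<mu> (- cball 0 r)"
  proof -
    have "- ball 0 r = (- cball 0 r) \<union> sphere (0::'a) r" by auto
    moreover have "- cball 0 r \<in> sets \<mu>" "sphere 0 r \<in> null_sets \<mu>"
      using \<open>0 < r\<close> null
      by (auto intro!: exponent_measure_measurable[OF \<mu>] intro: borel_closed)
    ultimately show ?thesis
      by (simp add: measure_def emeasure_Un_null_set)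
  qed
  then show "((\<lambda>t. t * \<P>(\<omega> in M. t < norm (V \<omega>))) \<longlongrightarrow> r * measure \<mu> (- ball 0 r)) at_top"
    using resc[OF lim[OF _ away(2)], of "\<lambda>t. \<P>(\<omega> in M. t < norm (V \<omega>))"] \<open>0 < r\<close>
    by (simp add: frontier_complement field_simps not_le)
qed

text \<open>The unit sphere is not known to be null, so the convergence is not applied at radius 1.
  Instead 1 is squeezed between null radii, by monotonicity of the tail mass.\<close>

lemma radial_tail:
  fixes V :: "'w \<Rightarrow> 'a::euclidean_space"
  assumes \<mu>: "exponent_measure M V \<mu>"
  shows "((\<lambda>t. t * \<P>(\<omega> in M. t \<le> norm (V \<omega>))) \<longlongrightarrow> measure \<mu> (- ball 0 1)) at_top"
    and "((\<lambda>t. t * \<P>(\<omega> in M. t < norm (V \<omega>))) \<longlongrightarrow> measure \<mu> (- ball 0 1)) at_top"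
proof -
  define g where "g r = measure \<mu> (- ball 0 r)" for r
  have anti: "g s \<le> g r" if "0 < r" "r \<le> s" for r s
    unfolding g_def
  proof (rule measure_mono_fmeasurable)
    show "- ball 0 r \<in> fmeasurable \<mu>"
      using \<open>0 < r\<close> exponent_measure_finite_tail[OF \<mu>]
      by (intro fmeasurableI exponent_measure_measurable[OF \<mu>]) auto
    show "- ball 0 s \<in> sets \<mu>"
      using that by (intro exponent_measure_measurable[OF \<mu>]) auto
  qed (use that in auto)
  obtain r\<^sub>0 where r0: "0 < r\<^sub>0" "emeasure \<mu> (sphere 0 r\<^sub>0) = 0"
    using exponent_measure_null_sphere[OF \<mu>, of 1 2] by (auto intro: less_trans[OF zero_less_one])
  define C where "C = r\<^sub>0 * g r\<^sub>0"
  \<comment> \<open>Both limits belong to the same function of \<open>t\<close>, so they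
    agree.\<close>
  have C: "r * g r = C" if "0 < r" "emeasure \<mu> (sphere 0 r) = 0" for r
    unfolding C_def g_def
    by (rule tendsto_unique[OF _ radial_tail_scaled(1)[OF \<mu> that] radial_tail_scaled(1)[OF \<mu> r0]]) simp
  \<comment> \<open>Each inequality is proved up to a factor \<open>z < 1\<close>: a null radius in
    \<open>(z, 1)\<close> bounds \<open>g 1\<close> from above, one in \<open>(1, 1 / z)\<close>
    bounds it from below.\<close>
  have "g 1 = C"
  proof (rule antisym; rule field_le_mult_one_interval)
    fix z :: real assume z: "0 < z" "z < 1"
    obtain r where r: "z < r" "r < 1" "emeasure \<mu> (sphere 0 r) = 0"
      using exponent_measure_null_sphere[OF \<mu> z] by blast
    have "z * g 1 \<le> r * g r"
      using r z anti[of r 1] by (intro mult_mono) (auto simp: g_def)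
    then show "z * g 1 \<le> C" using C r z by simp
    obtain s where s: "1 < s" "s < 1 / z" "emeasure \<mu> (sphere 0 s) = 0"
      using exponent_measure_null_sphere[OF \<mu>, of 1 "1 / z"] z by auto
    have "C = s * g s" using C s by simp
    also have "\<dots> \<le> 1 / z * g 1"
      using s z anti[of 1 s] by (intro mult_mono) (auto simp: g_def)
    finally show "z * C \<le> g 1" using z by (simp add: field_simps)
  qed
  then have "r\<^sub>0 * measure \<mu> (- ball 0 r\<^sub>0) = measure \<mu> (- ball 0 1)"
    by (simp add: C_def g_def)
  then show "((\<lambda>t. t * \<P>(\<omega> in M. t \<le> norm (V \<omega>))) \<longlongrightarrow> measure \<mu> (- ball 0 1)) at_top"
    and "((\<lambda>t. t * \<P>(\<omega> in M. t < norm (V \<omega>))) \<longlongrightarrow> measure \<mu> (- ball 0 1)) at_top"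
    using radial_tail_scaled[OF \<mu> r0] by simp_all
qed

section \<open>Total mass and normalization of the angular measure\<close>

text \<open>By polar coordinates \<open>x = norm x *\<^sub>R sgn x\<close>, the cone over the whole
  sphere is the outside of the open unit ball. This identifies the total angular mass with the limit
  in \<open>radial_tail\<close>.\<close>

lemma emeasure_angular_measure_sphere:
  fixes V :: "'w \<Rightarrow> 'a::euclidean_space"
  assumes "exponent_measure M V \<mu>"
  shows "emeasure (angular_measure \<mu>) (sphere 0 1) = emeasure \<mu> (- ball 0 1)"
proof -
  have "{t *\<^sub>R w | t w. w \<in> sphere (0::'a) 1 \<and> t \<ge> 1} = - ball 0 1"
  proof (intro set_eqI iffI)
    fix x :: 'a assume "x \<in> - ball 0 1"
    then have "norm x \<ge> 1" "x \<noteq> 0"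
      by auto
    then have "x = norm x *\<^sub>R sgn x" "sgn x \<in> sphere 0 1" "norm x \<ge> 1"
      by (simp_all add: sgn_div_norm)
    then show "x \<in> {t *\<^sub>R w | t w. w \<in> sphere (0::'a) 1 \<and> t \<ge> 1}" by blast
  qed auto
  moreover have "sphere 0 1 \<in> sets (restrict_space borel (sphere (0::'a) 1))"
    by (subst sets_restrict_space_iff) (auto intro: borel_closed)
  ultimately show ?thesis
    using assms by (subst emeasure_angular_measure) (auto simp: exponent_measure_def)
qed

lemma space_angular_measure: "space (angular_measure \<mu>) = sphere 0 1"
  and sets_angular_measure: "sets (angular_measure \<mu>) = sets (restrict_space borel (sphere 0 1))"
proof -
  have sub: "sets (restrict_space borel (sphere (0::'a) 1)) \<subseteq> Pow (sphere 0 1)"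
    using sets.space_closed[of "restrict_space borel (sphere (0::'a) 1)"]
    by (simp add: space_restrict_space)
  show "space (angular_measure \<mu>) = sphere 0 1"
    unfolding angular_measure_def using sub by (rule space_measure_of)
  show "sets (angular_measure \<mu>) = sets (restrict_space borel (sphere 0 1))"
    unfolding angular_measure_def using sub
      sets.sigma_sets_eq[of "restrict_space borel (sphere (0::'a) 1)"]
    by (simp add: space_restrict_space)
qed

text \<open>If \<open>\<mu> (- ball 0 1) = 0\<close>, the scaling factor is \<open>\<infinity>\<close>, but the angular measure is zero, so that
  the division by zero below still gives the right value.\<close>

lemma
  fixes V :: "'w \<Rightarrow> 'a::euclidean_space"
  assumes \<mu>: "exponent_measure M V \<mu>"
  shows measure_angular_measure_le: "measure (angular_measure \<mu>) A \<le> measure \<mu> (- ball 0 1)"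
    and measure_normalized_angular_measure:
      "measure (normalized_angular_measure \<mu>) A = measure (angular_measure \<mu>) A / measure \<mu> (- ball 0 1)"
proof -
  let ?\<Phi> = "angular_measure \<mu>"
  have fin: "emeasure \<mu> (- ball 0 1) < \<infinity>"
    using exponent_measure_finite_tail[OF \<mu>, of 1] by simp
  then interpret \<Phi>: finite_measure ?\<Phi>
    by (intro finite_measureI) (simp add: space_angular_measure emeasure_angular_measure_sphere[OF \<mu>])
  have "measure ?\<Phi> A \<le> measure ?\<Phi> (space ?\<Phi>)"
    by (rule \<Phi>.bounded_measure)
  also have "\<dots> = measure \<mu> (- ball 0 1)"
    by (simp add: space_angular_measure measure_def emeasure_angular_measure_sphere[OF \<mu>])
  finally show le: "measure ?\<Phi> A \<le> measure \<mu> (- ball 0 1)" .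
  show "measure (normalized_angular_measure \<mu>) A = measure ?\<Phi> A / measure \<mu> (- ball 0 1)"
    unfolding normalized_angular_measure_def measure_def
    using fin
    by (cases "emeasure \<mu> (- ball 0 1)" rule: ennreal_cases; cases "emeasure \<mu> (- ball 0 1) = 0")
      (auto simp: enn2real_mult inverse_ennreal divide_ennreal_def divide_inverse order_le_less)
qed

section \<open>Uniform convergence over halfspaces\<close>

text \<open>The hypothesis conditions on \<open>norm (V \<omega>) > t\<close>, whereas polar depth
  uses the weak inequality. The mass of the sphere of radius \<open>t\<close> separating the two is
  negligible after scaling by \<open>t\<close>, since both radial tails have the same limit.\<close>

lemma uniform_halfspace_convergence:
  fixes V :: "'w \<Rightarrow> 'a::euclidean_space"
  assumes "prob_space M" and [measurable]: "V \<in> M \<rightarrow>\<^sub>M borel" and \<mu>: "exponent_measure M V \<mu>"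
    and conv: "((\<lambda>t. SUP u \<in> sphere 0 1.
          \<bar>\<P>(\<omega> in M. sgn (V \<omega>) \<in> halfspace0 u \<inter> sphere 0 1 \<bar> norm (V \<omega>) > t)
            - measure (normalized_angular_measure \<mu>) (halfspace0 u \<inter> sphere 0 1)\<bar>)
          \<longlongrightarrow> 0) at_top"
    and "0 < \<epsilon>"
  shows "\<forall>\<^sub>F t in at_top. \<forall>u \<in> sphere 0 1.
    \<bar>t * \<P>(\<omega> in M. t \<le> norm (V \<omega>) \<and> V \<omega> \<in> halfspace0 u)
      - measure (angular_measure \<mu>) (sphere 0 1 \<inter> halfspace0 u)\<bar> \<le> \<epsilon>"
proof -
  interpret prob_space M by fact
  define C where "C = measure \<mu> (- ball 0 1)"
  define \<Phi> where "\<Phi> u = measure (angular_measure \<mu>) (sphere 0 1 \<inter> halfspace0 u)" for u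
  define p where "p t = \<P>(\<omega> in M. t < norm (V \<omega>))" for t
  define p' where "p' t = \<P>(\<omega> in M. t \<le> norm (V \<omega>))" for t
  define q where "q t u = \<P>(\<omega> in M. sgn (V \<omega>) \<in> halfspace0 u \<inter> sphere 0 1 \<bar> norm (V \<omega>) > t)" for t u
  define h where "h t = (SUP u \<in> sphere 0 1. \<bar>q t u
      - measure (normalized_angular_measure \<mu>) (halfspace0 u \<inter> sphere 0 1)\<bar>)" for t
  have [measurable]: "halfspace0 u \<in> sets borel" for u :: 'a
    unfolding halfspace0_def by measurable
  have C0: "0 \<le> C" by (simp add: C_def)
  have \<Phi>0: "0 \<le> \<Phi> u" and \<Phi>C: "\<Phi> u \<le> C" for u
    unfolding \<Phi>_def C_def using measure_angular_measure_le[OF \<mu>] by auto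
  have norm\<Phi>: "measure (normalized_angular_measure \<mu>) (halfspace0 u \<inter> sphere 0 1) = \<Phi> u / C" for u
    unfolding \<Phi>_def C_def by (simp add: measure_normalized_angular_measure[OF \<mu>] Int_commute)
  have pp': "p t \<le> p' t" for t
    unfolding p_def p'_def by (intro finite_measure_mono) auto
  have p0: "0 \<le> p t" for t
    by (simp add: p_def)
  \<comment> \<open>If \<open>p t = 0\<close>, the quotient defining \<open>q t u\<close> is 0, so
    the bounds hold for every \<open>t\<close>.\<close>
  have q01: "0 \<le> q t u" "q t u \<le> 1" for t u
  proof -
    have "\<P>(\<omega> in M. sgn (V \<omega>) \<in> halfspace0 u \<inter> sphere 0 1 \<and> norm (V \<omega>) > t) \<le> p t"
      unfolding p_def by (intro finite_measure_mono) auto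
    then show "q t u \<le> 1"
      using p0[of t] unfolding q_def cond_prob_def p_def[symmetric]
      by (auto simp: divide_le_eq_1 order_le_less)
  qed (simp add: q_def cond_prob_def)
  \<comment> \<open>A real supremum dominates its members only if the family is bounded; here 1 is a
    bound, also for \<open>C = 0\<close>, where \<open>\<Phi> u / C\<close> is 0.\<close>
  have h: "\<bar>q t u - \<Phi> u / C\<bar> \<le> h t" if "u \<in> sphere 0 1" for t u
    unfolding h_def norm\<Phi>
  proof (rule cSUP_upper[OF that], rule bdd_aboveI2)
    fix u
    have "0 \<le> \<Phi> u / C" "\<Phi> u / C \<le> 1"
      using \<Phi>0[of u] \<Phi>C[of u] C0 by (auto simp: divide_le_eq_1)
    then show "\<bar>q t u - \<Phi> u / C\<bar> \<le> 1"
      using q01[of t u] by linarith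
  qed
  \<comment> \<open>An error bound free of \<open>u\<close>: radial convergence, assumed angular
    convergence, and the passage from strict to weak exceedance.\<close>
  define e where "e t = \<bar>t * p t - C\<bar> + C * h t + \<bar>t * p' t - t * p t\<bar>" for t
  have lp: "((\<lambda>t. t * p t) \<longlongrightarrow> C) at_top" "((\<lambda>t. t * p' t) \<longlongrightarrow> C) at_top"
    unfolding p_def p'_def C_def using radial_tail[OF \<mu>] by auto
  have lh: "(h \<longlongrightarrow> 0) at_top"
    using conv unfolding h_def q_def .
  have "(e \<longlongrightarrow> \<bar>C - C\<bar> + C * 0 + \<bar>C - C\<bar>) at_top"
    unfolding e_def by (intro tendsto_intros lp lh)
  then have "\<forall>\<^sub>F t in at_top. e t < \<epsilon>"
    using \<open>0 < \<epsilon>\<close> by (intro order_tendstoD(2)) auto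
  then show ?thesis
    using eventually_gt_at_top[of 0]
  proof eventually_elim
    case (elim t)
    show ?case
    proof
      fix u :: 'a assume u: "u \<in> sphere 0 1"
      define m where "m = \<P>(\<omega> in M. t \<le> norm (V \<omega>) \<and> V \<omega> \<in> halfspace0 u)"
      define m' where "m' = \<P>(\<omega> in M. t < norm (V \<omega>) \<and> V \<omega> \<in> halfspace0 u)"
      \<comment> \<open>Halfspaces through the origin are cones, and exceeding \<open>t > 0\<close>
        excludes \<open>V \<omega> = 0\<close>.\<close>
      have "sgn (V \<omega>) \<in> halfspace0 u \<inter> sphere 0 1 \<and> t < norm (V \<omega>) \<longleftrightarrow>
          t < norm (V \<omega>) \<and> V \<omega> \<in> halfspace0 u" for \<omega>
        using \<open>0 < t\<close> by (cases "V \<omega> = 0")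
          (auto simp: halfspace0_def sgn_div_norm zero_le_mult_iff)
      then have qm: "q t u = m' / p t"
        by (simp add: q_def cond_prob_def m'_def p_def)
      have "m' \<le> p t"
        unfolding m'_def p_def by (intro finite_measure_mono) auto
      moreover have "0 \<le> m'" by (simp add: m'_def)
      \<comment> \<open>For \<open>p t = 0\<close> both sides vanish because
        \<open>m' \<le> p t\<close>.\<close>
      ultimately have m'q: "m' = p t * q t u"
        unfolding qm by auto
      have "m' \<le> m"
        unfolding m_def m'_def by (intro finite_measure_mono) auto
      have "m \<le> m' + (p' t - p t)"
      proof -
        have "m \<le> \<P>(\<omega> in M. (t < norm (V \<omega>) \<and> V \<omega> \<in> halfspace0 u) \<or> norm (V \<omega>) = t)"
          unfolding m_def by (intro finite_measure_mono) auto
        also have "\<dots> = m' + \<P>(\<omega> in M. norm (V \<omega>) = t)"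
          unfolding m'_def
          by (subst finite_measure_Union[symmetric]) (auto intro!: arg_cong[where f = prob])
        also have "p' t = p t + \<P>(\<omega> in M. norm (V \<omega>) = t)"
          unfolding p_def p'_def
          by (subst finite_measure_Union[symmetric]) (auto intro!: arg_cong[where f = prob])
        then have "\<P>(\<omega> in M. norm (V \<omega>) = t) = p' t - p t" by simp
        finally show ?thesis .
      qed
      then have 1: "\<bar>t * m - t * m'\<bar> \<le> \<bar>t * p' t - t * p t\<bar>"
        using \<open>m' \<le> m\<close> pp'[of t] \<open>0 < t\<close>
        by (simp add: abs_mult flip: right_diff_distrib)
      \<comment> \<open>If \<open>C = 0\<close>, then \<open>\<Phi> u = 0\<close> as well, so the
        identity survives the division by zero.\<close>
      have "t * m' - \<Phi> u = (t * p t - C) * q t u + C * (q t u - \<Phi> u / C)"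
        using \<Phi>0[of u] \<Phi>C[of u] by (auto simp: m'q field_simps)
      also have "\<bar>\<dots>\<bar> \<le> \<bar>t * p t - C\<bar> * 1 + C * h t"
        unfolding abs_mult using q01[of t u] C0 h[OF u, of t]
        by (intro order_trans[OF abs_triangle_ineq] add_mono)
          (auto simp: abs_mult intro!: mult_left_mono mult_left_le)
      finally have "\<bar>t * m - \<Phi> u\<bar> \<le> e t"
        using 1 abs_triangle_ineq[of "t * m - t * m'" "t * m' - \<Phi> u"]
        unfolding e_def by simp
      then show "\<bar>t * \<P>(\<omega> in M. t \<le> norm (V \<omega>) \<and> V \<omega> \<in> halfspace0 u)
          - measure (angular_measure \<mu>) (sphere 0 1 \<inter> halfspace0 u)\<bar> \<le> \<epsilon>"
        using elim unfolding m_def \<Phi>_def by linarith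
    qed
  qed
qed

section \<open>From halfspace probabilities to depths\<close>

text \<open>Taking infima does not increase the uniform distance, and a positive factor commutes
  with them. Nonnegativity bounds both families below, so that the real infima are genuine lower
  bounds.\<close>

lemma cINF_diff_le:
  fixes f g :: "'a \<Rightarrow> real"
  assumes "S \<noteq> {}" "0 < c" "\<And>u. u \<in> S \<Longrightarrow> 0 \<le> f u" "\<And>u. u \<in> S \<Longrightarrow> 0 \<le> g u"
    and le: "\<And>u. u \<in> S \<Longrightarrow> \<bar>c * f u - g u\<bar> \<le> e"
  shows "\<bar>c * (INF u\<in>S. f u) - (INF u\<in>S. g u)\<bar> \<le> e"
proof -
  have "c * (INF u\<in>S. f u) - e \<le> (INF u\<in>S. g u)"
  proof (rule cINF_greatest[OF \<open>S \<noteq> {}\<close>])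
    fix u assume u: "u \<in> S"
    have "(INF u\<in>S. f u) \<le> f u"
      using u assms(3) by (intro cINF_lower bdd_belowI2) auto
    then have "c * (INF u\<in>S. f u) \<le> c * f u"
      using \<open>0 < c\<close> by simp
    then show "c * (INF u\<in>S. f u) - e \<le> g u" using le[OF u] by linarith
  qed
  moreover have "((INF u\<in>S. g u) - e) / c \<le> (INF u\<in>S. f u)"
  proof (rule cINF_greatest[OF \<open>S \<noteq> {}\<close>])
    fix u assume u: "u \<in> S"
    have "(INF u\<in>S. g u) \<le> g u"
      using u assms(4) by (intro cINF_lower bdd_belowI2) auto
    then have "(INF u\<in>S. g u) - e \<le> c * f u" using le[OF u] by linarith
    then show "((INF u\<in>S. g u) - e) / c \<le> f u"
      using \<open>0 < c\<close> by (simp add: field_simps)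
  qed
  ultimately show ?thesis
    using \<open>0 < c\<close> by (simp add: field_simps abs_le_iff)
qed

text \<open>A nonzero \<open>y\<close> and \<open>sgn y\<close> lie in the same halfspaces through
  the origin, so both depths are infima over one set of directions; it contains
  \<open>sgn y\<close>.\<close>

lemma polar_depth_angular_depth_diff_le:
  fixes y :: "'a::euclidean_space"
  assumes "y \<noteq> 0"
    and "\<And>u. u \<in> sphere 0 1 \<Longrightarrow>
      \<bar>norm y * measure \<pi> {z. norm z \<ge> norm y \<and> z \<in> halfspace0 u}
        - measure \<phi> (sphere 0 1 \<inter> halfspace0 u)\<bar> \<le> e"
  shows "\<bar>norm y * polar_depth y \<pi> - angular_depth (sgn y) \<phi>\<bar> \<le> e"
proof -
  have "sgn y \<in> halfspace0 u \<longleftrightarrow> y \<in> halfspace0 u" for u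
    using assms(1) by (auto simp: halfspace0_def sgn_div_norm zero_le_mult_iff)
  moreover have "sgn y \<in> {u \<in> sphere 0 1. y \<in> halfspace0 u}"
    using assms(1) by (simp add: halfspace0_def norm_sgn sgn_div_norm)
  ultimately show ?thesis
    unfolding polar_depth_def angular_depth_def using assms
    by (auto intro!: cINF_diff_le)
qed

theorem proposition5p1:
  fixes M :: "'w measure" and X :: "'w \<Rightarrow> real ^ 'n" and P \<mu> :: "(real ^ 'n) measure"
    and V :: "'w \<Rightarrow> real ^ 'n" and B\<^sub>1 :: "real \<Rightarrow> real"
  assumes "CARD('n) \<ge> 2"
    and "prob_space M"
    and "X \<in> M \<rightarrow>\<^sub>M borel"
    and P: "P = distr M borel X"
    and "\<And>j. continuous_on UNIV (marginal_cdf P j)"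
    and V: "V = (\<lambda>\<omega>. standardize P (X \<omega>))"
    and "exponent_measure M V \<mu>"
    and B\<^sub>1: "\<And>t. B\<^sub>1 t = (SUP y \<in> {y. norm y \<ge> t}.
          \<bar>norm y * polar_depth y (distr P borel (standardize P))
            - angular_depth (sgn y) (angular_measure \<mu>)\<bar>)"
    and "((\<lambda>t. SUP u \<in> sphere 0 1.
          \<bar>\<P>(\<omega> in M. sgn (V \<omega>) \<in> halfspace0 u \<inter> sphere 0 1 \<bar> norm (V \<omega>) > t)
            - measure (normalized_angular_measure \<mu>) (halfspace0 u \<inter> sphere 0 1)\<bar>)
          \<longlongrightarrow> 0) at_top"
  shows "(B\<^sub>1 \<longlongrightarrow> 0) at_top"
proof (rule tendstoI)
  fix \<epsilon> :: real assume "0 < \<epsilon>"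
  interpret prob_space M by fact
  note [measurable] = \<open>X \<in> M \<rightarrow>\<^sub>M borel\<close>
  have [measurable]: "standardize P \<in> borel \<rightarrow>\<^sub>M borel"
    unfolding P by (intro measurable_standardize finite_measure_distr) auto
  have V_meas [measurable]: "V \<in> M \<rightarrow>\<^sub>M borel"
    unfolding V by measurable
  have "standardize P \<circ> X = V"
    by (simp add: V fun_eq_iff)
  \<comment> \<open>Only the measure being pushed forward is unfolded; the \<open>P\<close> inside
    \<open>standardize P\<close> stays.\<close>
  then have law: "distr P borel (standardize P) = distr M borel V"
    by (subst (1) P) (simp add: distr_distr)
  have prob_V: "measure (distr P borel (standardize P)) {z. norm z \<ge> s \<and> z \<in> halfspace0 u}
      = \<P>(\<omega> in M. s \<le> norm (V \<omega>) \<and> V \<omega> \<in> halfspace0 u)" for s u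
  proof -
    have "{z. norm z \<ge> s \<and> z \<in> halfspace0 u} \<in> sets borel"
      unfolding halfspace0_def by measurable
    then show ?thesis
      unfolding law by (subst measure_distr[OF V_meas]) (auto intro!: arg_cong[where f = prob])
  qed
  define d where "d y = \<bar>norm y * polar_depth y (distr P borel (standardize P))
      - angular_depth (sgn y) (angular_measure \<mu>)\<bar>" for y
  \<comment> \<open>The bound by half of \<epsilon> leaves room for the strict inequality after
    taking a supremum.\<close>
  obtain T where T: "\<And>t u. T \<le> t \<Longrightarrow> u \<in> sphere 0 1 \<Longrightarrow>
      \<bar>t * \<P>(\<omega> in M. t \<le> norm (V \<omega>) \<and> V \<omega> \<in> halfspace0 u)
        - measure (angular_measure \<mu>) (sphere 0 1 \<inter> halfspace0 u)\<bar> \<le> \<epsilon> / 2"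
    using uniform_halfspace_convergence[OF assms(2) V_meas assms(7,9) half_gt_zero[OF \<open>0 < \<epsilon>\<close>]]
    unfolding eventually_at_top_linorder by blast
  \<comment> \<open>The 1 in the maximum keeps the points \<open>y\<close> away from the
    origin.\<close>
  have "dist (B\<^sub>1 t) 0 < \<epsilon>" if t: "max 1 T \<le> t" for t
  proof -
    have d: "d y \<le> \<epsilon> / 2" if "y \<in> {y. norm y \<ge> t}" for y
      unfolding d_def
    proof (rule polar_depth_angular_depth_diff_le)
      show "y \<noteq> 0" using that t by auto
      show "\<bar>norm y * measure (distr P borel (standardize P)) {z. norm z \<ge> norm y \<and> z \<in> halfspace0 u}
          - measure (angular_measure \<mu>) (sphere 0 1 \<inter> halfspace0 u)\<bar> \<le> \<epsilon> / 2"
        if "u \<in> sphere 0 1" for u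
        \<comment> \<open>The threshold is \<open>norm y\<close> rather than \<open>t\<close>;
          \<open>T\<close> covers all thresholds from \<open>t\<close> on.\<close>
        unfolding prob_V using that \<open>y \<in> {y. norm y \<ge> t}\<close> t by (intro T) auto
    qed
    \<comment> \<open>A point in the index set makes the real supremum meaningful and bounds it
      below by \<open>d y\<close>, hence by 0.\<close>
    obtain y :: "real ^ 'n" where y: "y \<in> {y. norm y \<ge> t}"
      using vector_choose_size[of t] t by (metis le_max_iff_disj max.boundedE mem_Collect_eq order_refl order_trans zero_le_one)
    have B: "B\<^sub>1 t = (SUP y \<in> {y. norm y \<ge> t}. d y)"
      by (simp add: B\<^sub>1 d_def)
    have "B\<^sub>1 t \<le> \<epsilon> / 2"
      unfolding B using y d by (intro cSUP_least) auto
    moreover have "d y \<le> B\<^sub>1 t"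
      unfolding B using y d by (intro cSUP_upper bdd_aboveI2[of _ _ "\<epsilon> / 2"]) auto
    moreover have "0 \<le> d y" by (simp add: d_def)
    ultimately show ?thesis
      using \<open>0 < \<epsilon>\<close> by (simp add: dist_real_def)
  qed
  then show "\<forall>\<^sub>F t in at_top. dist (B\<^sub>1 t) 0 < \<epsilon>"
    unfolding eventually_at_top_linorder by blast
qed

end
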